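(* Let $m,n\geq 1$ be integers with $m\geq n$ and $m+n$ even. Then $$\int_0^\infty \frac{\tanh^{m+1}x}{x^{n+1}}\,dx = (-1)^{(m-n)/2}\sum_{p=\lceil n/2\rceil}^{(m+n)/2}\binom{2p}{n}\,(2^{2p+1}-1)\,\frac{\zeta(2p+1)}{\pi^{2p}}\,[u^{m+n-2p}](u\cot u)^{m+1}.$$
   Context: $\zeta$ is the Riemann zeta function. For a power series (or Laurent series) $F$, $[u^r]F(u)$ denotes the coefficient of $u^r$ in its expansion at the origin. The function $u\cot u$ is extended holomorphically to $u=0$ with value $1$. *)

theory Defs
  imports "HOL-Complex_Analysis.Complex_Analysis"
begin

(* The Dirichlet series; this is the Riemann zeta function on the half-plane Re s > 1.
   (For other s the series does not converge absolutely and the value is not meaningful.) *)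
definition zeta :: "complex \<Rightarrow> complex" where
  "zeta s = (\<Sum>k. 1 / of_nat (Suc k) powr s)"

(* u cot u with the removable singularity at 0 filled in (in HOL, 0 * cot 0 = 0). *)
definition ucot :: "complex \<Rightarrow> complex" where
  "ucot u = (if u = 0 then 1 else u * cot u)"

end

(* The integrand is even, so the integral is half the integral over the real line of
   tanh^(m+1) z / z^(n+1), whose singularity at 0 is removable as m >= n. Close the contour by the
   rectangle with corners -h, h, h + ih, -h + ih where h = pi N: there |tanh| <= 2, so the three extra
   sides contribute O(h^(-n)). Near the pole p_k = i pi (k + 1/2) one has tanh (p_k + w) = coth w, and
   w coth w = (iw) cot (iw), so the residue is a finite combination of the powers p_k^(-2p-1) with
   coefficients taken from (u cot u)^(m+1) (which is even, so only odd powers of p_k occur).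
   Summing over k turns these powers into (2^(2p+1) - 1) zeta(2p+1). Integrability comes for free by
   monotone convergence, since the integrand is nonnegative. *)
theory Submission
  imports Defs
begin

section \<open>Holomorphy and power series at the origin\<close>

definition tanhc :: "complex \<Rightarrow> complex" where
  "tanhc z = (if z = 0 then 1 else tanh z / z)"

text \<open>The singularity at 0 is removable: \<open>tanh\<close> vanishes there, and the value 1
  filled in is its derivative at 0. Holomorphy is proved on the open set where \<open>cosh\<close>
  is nonzero and then restricted, so that the rule applies to arbitrary sets
  \<open>A\<close>.\<close>

lemma tanhc_holomorphic_on [holomorphic_intros]:
  assumes "A \<subseteq> {z. cosh z \<noteq> 0}"
  shows "tanhc holomorphic_on A"
proof -
  let ?S = "{z::complex. cosh z \<noteq> 0}"
  have "open ?S"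
    by (intro open_Collect_neq continuous_intros)
  have D: "(tanh has_field_derivative 1 - tanh z ^ 2) (at z)" if "z \<in> ?S" for z :: complex
    using that by (auto intro!: derivative_eq_intros)
  have holo: "tanh holomorphic_on ?S"
    using D by (subst holomorphic_on_open[OF \<open>open ?S\<close>]) blast
  have D0: "deriv tanh (0::complex) = 1"
    using DERIV_imp_deriv[OF D, of 0] by simp
  have "tanhc holomorphic_on ?S"
    by (rule pole_theorem_open_0[where g = tanh and a = 0, OF holo \<open>open ?S\<close>]) (auto simp: tanhc_def D0)
  thus ?thesis
    using assms holomorphic_on_subset by blast
qed

lemma tanh_holomorphic_on [holomorphic_intros]:
  assumes "A \<subseteq> {z. cosh z \<noteq> (0::complex)}"
  shows "tanh holomorphic_on A"
proof -
  have "(\<lambda>z. z * tanhc z) holomorphic_on A"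
    using assms by (intro holomorphic_intros)
  thus ?thesis
    by (rule holomorphic_transform) (auto simp: tanhc_def)
qed

text \<open>Write \<open>ucot\<close> as \<open>cos\<close> divided by the completed quotient
  \<open>sin z / z\<close>, which has no zero in the disc because the nonzero zeros of
  \<open>sin\<close> have modulus at least pi. Radius 1 is a convenient choice; expansions at 0 only
  need some neighbourhood.\<close>

lemma ucot_holomorphic_on_ball: "ucot holomorphic_on ball 0 1"
proof -
  let ?sinc = "\<lambda>z::complex. if z = 0 then 1 else sin z / z"
  have D0: "deriv sin (0::complex) = 1"
    by (rule DERIV_imp_deriv) (auto intro!: derivative_eq_intros)
  have sinc: "?sinc holomorphic_on UNIV"
    by (rule pole_theorem_open_0[where g = sin and a = 0, OF holomorphic_on_sin]) (auto simp: D0)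
  have sin_nz: "sin z \<noteq> 0" if "z \<in> ball 0 1" "z \<noteq> 0" for z :: complex
  proof
    assume "sin z = 0"
    then obtain k :: int where k: "z = of_real (k * pi)"
      by (auto simp: sin_eq_0)
    with that have "k \<noteq> 0" by auto
    hence "1 * 1 \<le> \<bar>real_of_int k\<bar> * \<bar>pi\<bar>"
      using pi_gt3 by (intro mult_mono) auto
    thus False
      using that k by (simp add: norm_mult abs_mult)
  qed
  have "(\<lambda>z. cos z / ?sinc z) holomorphic_on ball 0 1"
    by (intro holomorphic_intros holomorphic_on_subset[OF sinc]) (use sin_nz in auto)
  thus ?thesis
    by (rule holomorphic_transform) (auto simp: ucot_def cot_def)
qed

lemma ucot_minus: "ucot (-u) = ucot u"
  by (simp add: ucot_def cot_def)

lemma ucot_power_has_fps_expansion: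
  "(\<lambda>u. ucot u ^ k) has_fps_expansion fps_expansion (\<lambda>u. ucot u ^ k) 0"
  by (rule has_fps_expansion_fps_expansion[of "ball 0 1"])
     (auto intro!: holomorphic_intros ucot_holomorphic_on_ball)

text \<open>As \<open>ucot\<close> is even, composing the series with \<open>-X\<close> gives an
  expansion of the same function. Uniqueness of expansions then forces \<open>(-1) ^ j\<close> times
  the coefficient to equal the coefficient.\<close>

lemma fps_expansion_ucot_power_odd:
  assumes "odd j"
  shows "fps_nth (fps_expansion (\<lambda>u. ucot u ^ k) 0) j = 0"
proof -
  let ?A = "fps_expansion (\<lambda>u. ucot u ^ k) 0"
  have "((\<lambda>u. ucot u ^ k) \<circ> (\<lambda>u. (-1) * u)) has_fps_expansion fps_compose ?A (fps_const (-1) * fps_X)"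
    by (intro has_fps_expansion_compose ucot_power_has_fps_expansion fps_expansion_intros) auto
  hence "(\<lambda>u. ucot u ^ k) has_fps_expansion fps_compose ?A (fps_const (-1) * fps_X)"
    by (simp add: o_def ucot_minus)
  hence "fps_compose ?A (fps_const (-1) * fps_X) = ?A"
    using ucot_power_has_fps_expansion fps_expansion_unique_complex by blast
  hence "(-1) ^ j * fps_nth ?A j = fps_nth ?A j"
    by (metis fps_nth_compose_linear)
  thus ?thesis using assms by simp
qed

text \<open>The binomial series, after factoring out \<open>z ^ Suc n\<close> and setting
  \<open>c = -1/z\<close>. It expands the factor of the integrand that is regular at a pole
  \<open>z\<close>, in the local variable \<open>w\<close>.\<close>

lemma inverse_power_has_fps_expansion:
  fixes z :: complex
  assumes "z \<noteq> 0"
  shows "(\<lambda>w. inverse ((z + w) ^ Suc n)) has_fps_expansion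
           Abs_fps (\<lambda>k. of_nat (n + k choose n) * (-1) ^ k / z ^ (n + 1 + k))"
proof -
  define c where "c = - inverse z"
  have "(\<lambda>w. inverse (z ^ Suc n) * inverse ((1 - c * w) ^ Suc n)) has_fps_expansion
          fps_const (inverse (z ^ Suc n)) * inverse ((1 - fps_const c * fps_X) ^ Suc n)"
    by (intro fps_expansion_intros) (auto simp: fps_power_zeroth)
  also have "fps_const (inverse (z ^ Suc n)) * inverse ((1 - fps_const c * fps_X) ^ Suc n) =
      Abs_fps (\<lambda>k. of_nat (n + k choose n) * (-1) ^ k / z ^ (n + 1 + k))"
    by (subst one_minus_const_fps_X_neg_power')
       (auto simp: fps_eq_iff c_def binomial_symmetric[of n] power_minus[of "1 / z"]
             power_add field_simps)
  also have "(\<lambda>w. inverse (z ^ Suc n) * inverse ((1 - c * w) ^ Suc n)) = (\<lambda>w. inverse ((z + w) ^ Suc n))"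
  proof
    fix w
    have "z * (1 - c * w) = z + w"
      using assms by (simp add: c_def field_simps)
    thus "inverse (z ^ Suc n) * inverse ((1 - c * w) ^ Suc n) = inverse ((z + w) ^ Suc n)"
      by (metis inverse_mult_distrib power_mult_distrib)
  qed
  finally show ?thesis .
qed

section \<open>Poles and size of \<open>tanh\<close>\<close>

definition tanh_pole :: "nat \<Rightarrow> complex" where
  "tanh_pole k = \<i> * of_real (pi / 2 * (2 * real k + 1))"

lemma tanh_pole_nonzero: "tanh_pole k \<noteq> 0"
proof -
  have "2 * real k + 1 > 0" by simp
  thus ?thesis unfolding tanh_pole_def by (simp del: of_real_add of_real_mult)
qed

text \<open>Multiplication by \<open>\<i>\<close> moves the pole to an odd multiple of pi/2 on the
  real axis, where \<open>cos\<close> is 0 and \<open>sin\<close> is 1 or -1. The addition formulas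
  then exchange \<open>sinh\<close> and \<open>cosh\<close>.\<close>

lemma
  shows sinh_tanh_pole_add: "sinh (tanh_pole k + w) = (-1) ^ k * \<i> * cosh w"
    and cosh_tanh_pole_add: "cosh (tanh_pole k + w) = (-1) ^ k * \<i> * sinh w"
proof -
  have eq: "\<i> * tanh_pole k = - complex_of_real (real k * pi + pi / 2)"
    unfolding tanh_pole_def by (simp add: algebra_simps)
  have "sinh (tanh_pole k) = \<i> * of_real (sin (real k * pi + pi / 2))"
    unfolding sinh_conv_sin eq sin_minus sin_of_real by simp
  hence 1: "sinh (tanh_pole k) = (-1) ^ k * \<i>"
    by (simp add: sin_add)
  have "cosh (tanh_pole k) = of_real (cos (real k * pi + pi / 2))"
    unfolding cosh_conv_cos eq cos_minus cos_of_real ..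
  hence 2: "cosh (tanh_pole k) = 0"
    by (simp add: cos_add)
  show "sinh (tanh_pole k + w) = (-1) ^ k * \<i> * cosh w"
       "cosh (tanh_pole k + w) = (-1) ^ k * \<i> * sinh w"
    by (simp_all add: sinh_add cosh_add 1 2)
qed

text \<open>The common factor \<open>(-1) ^ k * \<i>\<close> cancels and leaves coth w. This shows
  the pole to be simple and brings in \<open>ucot\<close>.\<close>

lemma tanh_tanh_pole_add:
  assumes "w \<noteq> 0"
  shows "tanh (tanh_pole k + w) = ucot (\<i> * w) / w"
proof -
  have "tanh (tanh_pole k + w) = cosh w / sinh w"
    unfolding tanh_def sinh_tanh_pole_add cosh_tanh_pole_add by simp
  also have "\<dots> = ucot (\<i> * w) / w"
    using assms by (simp add: ucot_def cot_def sinh_conv_sin cosh_conv_cos divide_simps)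
  finally show ?thesis .
qed

lemma cosh_eq_0_iff_tanh_pole:
  assumes "Im z > - (pi / 2)"
  shows "cosh z = 0 \<longleftrightarrow> z \<in> range tanh_pole"
proof
  assume "cosh z = 0"
  then obtain k :: int where k: "\<i> * z = of_real (k * pi) + of_real pi / 2"
    by (auto simp: cosh_conv_cos cos_eq_0)
  have Re: "Re z = 0" and Im: "Im z = - (k * pi) - pi / 2"
    using arg_cong[OF k, of Im] arg_cong[OF k, of Re] by simp_all
  have "of_int k * pi < 0 * pi"
    using assms Im by simp
  hence "k < 0"
    by (subst (asm) mult_less_cancel_right) auto
  \<comment> \<open>The rotation by \<open>\<i>\<close> reverses the order of the zeros:
    \<open>-(k + 1/2) = j + 1/2\<close> forces \<open>j = -k - 1\<close>, which is nonnegative as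
    \<open>k < 0\<close>.\<close>
  define j where "j = nat (- k - 1)"
  have "real_of_int k = - real j - 1"
    using \<open>k < 0\<close> by (simp add: j_def)
  hence "z = tanh_pole j"
    using Re unfolding complex_eq_iff Im \<open>real_of_int k = _\<close> by (simp add: tanh_pole_def algebra_simps)
  thus "z \<in> range tanh_pole"
    by blast
next
  assume "z \<in> range tanh_pole"
  then obtain k where "z = tanh_pole k" by blast
  thus "cosh z = 0"
    using cosh_tanh_pole_add[of k 0] by simp
qed

text \<open>The two alternatives fit the top side and the vertical sides of the contour. Both
  squared norms are expressed through \<open>e + inverse e\<close> and \<open>c\<close>, which
  reduces the claim to a linear inequality.\<close>

lemma norm_tanh_le_2:
  assumes "cos (2 * Im z) = 1 \<or> \<bar>Re z\<bar> \<ge> 1"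
  shows "norm (tanh z) \<le> 2"
proof -
  define e where "e = exp (2 * \<bar>Re z\<bar>)"
  define c where "c = cos (2 * Im z)"
  have "e \<ge> 1"
    by (simp add: e_def)
  have e: "exp (2 * Im (\<i> * z)) + inverse (exp (2 * Im (\<i> * z))) = e + inverse e"
    by (cases "Re z \<ge> 0") (auto simp: e_def exp_minus)
  have c: "cos (2 * Re (\<i> * z)) = c"
    by (simp add: c_def)
  have s2: "norm (sinh z) ^ 2 = (e + inverse e - 2 * c) / 4"
    using norm_sin_squared[of "\<i> * z"] unfolding e c
    by (simp add: sinh_conv_sin norm_mult)
  have c2: "norm (cosh z) ^ 2 = (e + inverse e + 2 * c) / 4"
  proof -
    \<comment> \<open>\<open>norm_cos_squared\<close> is stated with undoubled arguments, unlike
      \<open>norm_sin_squared\<close>, hence the two conversions to \<open>e\<close> and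
      \<open>c\<close>.\<close>
    have "(exp (Re z) - inverse (exp (Re z))) ^ 2 = e + inverse e - 2"
      using e by (simp add: exp_double power_inverse power2_diff)
    moreover have "c = 2 * cos (Im z) ^ 2 - 1"
      by (simp add: c_def cos_double_cos)
    ultimately show ?thesis
      using norm_cos_squared[of "\<i> * z"]
      by (simp add: cosh_conv_cos algebra_simps)
  qed
  \<comment> \<open>This is \<open>norm (sinh z) ^ 2 \<le> 4 * norm (cosh z) ^ 2\<close> with
    denominators cleared.\<close>
  have "- 10 * c \<le> 3 * (e + inverse e)"
    using assms
  proof
    assume "cos (2 * Im z) = 1"
    hence "c = 1" by (simp add: c_def)
    thus ?thesis using \<open>e \<ge> 1\<close> 
      by (smt (verit) inverse_positive_iff_positive)
  next
    assume "\<bar>Re z\<bar> \<ge> 1"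
    hence "exp 2 \<le> e"
      by (simp add: e_def)
    \<comment> \<open>The quadratic Taylor bound gives \<open>exp 2 \<ge> 1 + 2 + 2\<close>; then
      \<open>3 * e \<ge> 15\<close>, which exceeds 10.\<close>
    hence "5 \<le> e"
      using exp_lower_Taylor_quadratic[of 2] by simp
    moreover have "c \<ge> -1"
      by (simp add: c_def)
    ultimately have "- 10 * c \<le> 3 * e"
      by linarith
    also have "\<dots> \<le> 3 * (e + inverse e)"
      using \<open>e \<ge> 1\<close> by simp
    finally show ?thesis .
  qed
  hence "norm (sinh z) ^ 2 \<le> (2 * norm (cosh z)) ^ 2"
    unfolding power_mult_distrib s2 c2 by (simp add: field_simps)
  hence *: "norm (sinh z) \<le> 2 * norm (cosh z)"
    by (rule power2_le_imp_le) simp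
  show ?thesis
    \<comment> \<open>If \<open>cosh z = 0\<close>, division by zero makes \<open>tanh z\<close>
      equal to 0 in HOL.\<close>
    using * by (cases "cosh z = 0") (auto simp: tanh_def norm_divide divide_simps)
qed

section \<open>Residues at the poles\<close>

text \<open>In the variable \<open>w = z - tanh_pole k\<close> the function is a holomorphic
  function divided by \<open>w ^ Suc m\<close>. The residue is therefore the coefficient of
  \<open>w ^ m\<close> in the numerator, a Cauchy product of the series of
  \<open>ucot (\<i> * w) ^ Suc m\<close> and the binomial series.\<close>

lemma residue_tanh_power:
  fixes m n k :: nat
  defines "a \<equiv> fps_nth (fps_expansion (\<lambda>u. ucot u ^ Suc m) 0)"
  shows "residue (\<lambda>z. tanh z ^ Suc m / z ^ Suc n) (tanh_pole k) =
           (\<Sum>j\<le>m. \<i> ^ j * a j * (of_nat (n + m - j choose n) * (-1) ^ (m - j)) /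
              tanh_pole k ^ (n + m + 1 - j))"
proof -
  let ?p = "tanh_pole k"
  define A where "A = fps_expansion (\<lambda>u. ucot u ^ Suc m) 0"
  define B where "B = Abs_fps (\<lambda>k. of_nat (n + k choose n) * (-1) ^ k / ?p ^ (n + 1 + k))"
  have "((\<lambda>u. ucot u ^ Suc m) \<circ> (\<lambda>u. \<i> * u)) has_fps_expansion fps_compose A (fps_const \<i> * fps_X)"
    unfolding A_def
    by (intro has_fps_expansion_compose ucot_power_has_fps_expansion fps_expansion_intros) auto
  hence "(\<lambda>w. ucot (\<i> * w) ^ Suc m) has_fps_expansion fps_compose A (fps_const \<i> * fps_X)"
    by (simp add: o_def)
  moreover have "(\<lambda>w. inverse ((?p + w) ^ Suc n)) has_fps_expansion B"
    unfolding B_def by (rule inverse_power_has_fps_expansion[OF tanh_pole_nonzero])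
  ultimately have exp: "(\<lambda>w. ucot (\<i> * w) ^ Suc m * inverse ((?p + w) ^ Suc n)) has_fps_expansion
      fps_compose A (fps_const \<i> * fps_X) * B"
    by (rule has_fps_expansion_mult)
  have "residue (\<lambda>z. tanh z ^ Suc m / z ^ Suc n) ?p =
        residue (\<lambda>w. tanh (?p + w) ^ Suc m / (?p + w) ^ Suc n) 0"
    by (rule residue_shift_0)
  also have "\<dots> = residue (\<lambda>w. ucot (\<i> * w) ^ Suc m * inverse ((?p + w) ^ Suc n) / w ^ Suc m) 0"
    by (intro residue_cong eventually_at_filter[THEN iffD2] always_eventually refl)
       (simp add: tanh_tanh_pole_add power_divide divide_inverse power_mult_distrib power_inverse mult_ac
             del: power_Suc)
  also have "\<dots> = fps_nth (fps_compose A (fps_const \<i> * fps_X) * B) m"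
    by (rule residue_fps_expansion_over_power_at_0[OF exp])
  also have "\<dots> = (\<Sum>j\<le>m. \<i> ^ j * fps_nth A j * fps_nth B (m - j))"
    by (simp add: fps_mult_nth atLeast0AtMost)
  also have "\<dots> = (\<Sum>j\<le>m. \<i> ^ j * fps_nth A j * (of_nat (n + m - j choose n) * (-1) ^ (m - j)) /
              tanh_pole k ^ (n + m + 1 - j))"
  proof (rule sum.cong)
    fix j assume "j \<in> {..m}"
    hence "n + (m - j) = n + m - j" "n + 1 + (m - j) = n + m + 1 - j" by auto
    hence "fps_nth B (m - j) = of_nat (n + m - j choose n) * (-1) ^ (m - j) / ?p ^ (n + m + 1 - j)"
      unfolding B_def fps_nth_Abs_fps by metis
    thus "\<i> ^ j * fps_nth A j * fps_nth B (m - j) =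
            \<i> ^ j * fps_nth A j * (of_nat (n + m - j choose n) * (-1) ^ (m - j)) /
              ?p ^ (n + m + 1 - j)"
      by simp
  qed auto
  finally show ?thesis
    by (simp add: A_def a_def)
qed

section \<open>Zeta values as sums over odd integers and over the poles\<close>

lemma zeta_of_nat: "zeta (of_nat r) = (\<Sum>k. 1 / of_nat (Suc k) ^ r)"
  unfolding zeta_def by (simp add: powr_nat del: of_nat_Suc)

lemma zeta_sums:
  assumes "r \<ge> 2"
  shows "(\<lambda>k. 1 / of_nat (Suc k) ^ r) sums zeta (of_nat r)"
proof -
  have "summable (\<lambda>k. inverse ((of_nat (Suc k) :: complex) ^ r))"
    using inverse_power_summable[OF assms] by (subst summable_Suc_iff)
  thus ?thesis
    unfolding zeta_of_nat by (intro summable_sums) (simp add: inverse_eq_divide)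
qed

text \<open>Group the zeta series in consecutive pairs and subtract the even terms, which sum to
  \<open>zeta (of_nat r) / 2 ^ r\<close>.\<close>

lemma zeta_odd_sums:
  assumes "r \<ge> 2"
  shows "(\<lambda>k. 1 / of_nat (2 * k + 1) ^ r) sums ((1 - 1 / 2 ^ r) * zeta (of_nat r))"
proof -
  let ?g = "\<lambda>k. 1 / of_nat (Suc k) ^ r :: complex"
  have "(\<lambda>n. sum ?g {n * 2..<n * 2 + 2}) sums zeta (of_nat r)"
    by (rule sums_group[OF zeta_sums[OF assms]]) simp
  moreover have "(\<lambda>k. 1 / 2 ^ r * ?g k) sums (1 / 2 ^ r * zeta (of_nat r))"
    by (rule sums_mult[OF zeta_sums[OF assms]])
  ultimately have "(\<lambda>n. sum ?g {n * 2..<n * 2 + 2} - 1 / 2 ^ r * ?g n) sums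
      (zeta (of_nat r) - 1 / 2 ^ r * zeta (of_nat r))"
    by (rule sums_diff)
  moreover have "sum ?g {n * 2..<n * 2 + 2} - 1 / 2 ^ r * ?g n = 1 / of_nat (2 * n + 1) ^ r" for n
  proof -
    \<comment> \<open>Indices are shifted by one: index \<open>2 * n\<close> carries the odd number
      \<open>2 * n + 1\<close>, and index \<open>2 * n + 1\<close> the even number
      \<open>2 * (n + 1)\<close>, whose term cancels.\<close>
    have "{n * 2..<n * 2 + 2} = {2 * n, 2 * n + 1}" by auto
    moreover have "of_nat (Suc (2 * n + 1)) = 2 * (of_nat (Suc n) :: complex)" by simp
    ultimately show ?thesis
      by (simp add: power_mult_distrib del: of_nat_Suc)
  qed
  ultimately show ?thesis
    by (simp add: algebra_simps)
qed

text \<open>Each pole is \<open>\<i> * pi / 2\<close> times an odd number; the resulting factor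
  \<open>2 ^ r\<close> turns \<open>1 - 1 / 2 ^ r\<close> into \<open>2 ^ r - 1\<close>.\<close>

lemma tanh_pole_sums:
  assumes "r \<ge> 2"
  shows "(\<lambda>k. 1 / tanh_pole k ^ r) sums ((2 ^ r - 1) * zeta (of_nat r) / (\<i> * of_real pi) ^ r)"
proof -
  have "(\<lambda>k. (2 / (\<i> * of_real pi)) ^ r * (1 / of_nat (2 * k + 1) ^ r)) sums
          ((2 / (\<i> * of_real pi)) ^ r * ((1 - 1 / 2 ^ r) * zeta (of_nat r)))"
    by (rule sums_mult[OF zeta_odd_sums[OF assms]])
  moreover have "(2 / (\<i> * of_real pi)) ^ r * (1 / of_nat (2 * k + 1) ^ r) = 1 / tanh_pole k ^ r" for k
    by (simp add: tanh_pole_def field_simps flip: power_mult_distrib)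
  moreover have "(2 / (\<i> * of_real pi)) ^ r * ((1 - 1 / 2 ^ r) * zeta (of_nat r)) =
      (2 ^ r - 1) * zeta (of_nat r) / (\<i> * of_real pi) ^ r"
    by (simp add: power_divide field_simps)
  ultimately show ?thesis by simp
qed

section \<open>The contour integral\<close>

text \<open>For \<open>n \<le> m\<close> this is the integrand with its removable singularity at 0
  filled in; the factorisation makes holomorphy at 0 immediate from that of
  \<open>tanhc\<close>.\<close>

definition tanh_quotient :: "nat \<Rightarrow> nat \<Rightarrow> complex \<Rightarrow> complex" where
  "tanh_quotient m n z = tanhc z ^ Suc n * tanh z ^ (m - n)"

lemma tanh_quotient_eq:
  assumes "n \<le> m" "z \<noteq> 0"
  shows "tanh_quotient m n z = tanh z ^ Suc m / z ^ Suc n"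
proof -
  have "Suc n + (m - n) = Suc m"
    using assms(1) by simp
  hence "tanh z ^ Suc n * tanh z ^ (m - n) = tanh z ^ Suc m"
    unfolding power_add[symmetric] by (rule arg_cong)
  thus ?thesis
    using assms(2) unfolding tanh_quotient_def tanhc_def
    by (simp add: power_divide del: power_Suc)
qed

lemma residue_tanh_quotient:
  assumes "n \<le> m"
  shows "residue (tanh_quotient m n) (tanh_pole k) =
         residue (\<lambda>z. tanh z ^ Suc m / z ^ Suc n) (tanh_pole k)"
proof (rule residue_cong)
  have "eventually (\<lambda>z. z \<in> - {0}) (at (tanh_pole k))"
    using tanh_pole_nonzero by (intro eventually_at_in_open') auto
  thus "\<forall>\<^sub>F z in at (tanh_pole k). tanh_quotient m n z = tanh z ^ Suc m / z ^ Suc n"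
    by eventually_elim (auto simp: tanh_quotient_eq[OF assms])
qed auto

lemma norm_tanh_quotient_le:
  assumes "n \<le> m" "h > 0" "h \<le> norm z" "cos (2 * Im z) = 1 \<or> \<bar>Re z\<bar> \<ge> 1"
  shows "norm (tanh_quotient m n z) \<le> 2 ^ Suc m / h ^ Suc n"
proof -
  have "norm (tanh_quotient m n z) = norm (tanh z) ^ Suc m / norm z ^ Suc n"
    using assms by (subst tanh_quotient_eq) (auto simp: norm_divide norm_power norm_mult)
  also have "\<dots> \<le> 2 ^ Suc m / h ^ Suc n"
    using assms norm_tanh_le_2[of z]
    by (intro frac_le power_mono) auto
  finally show ?thesis .
qed

lemma inj_tanh_pole: "inj tanh_pole"
  by (auto simp: inj_on_def tanh_pole_def)

text \<open>By the residue theorem the difference is the integral over the two vertical sides and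
  the top, of total length \<open>4 * h\<close>. The choice of \<open>h\<close> puts the top side
  strictly between the poles of index \<open>N - 1\<close> and \<open>N\<close>.\<close>

lemma tanh_quotient_contour_bound:
  fixes m n N :: nat
  assumes "n \<le> m" "N \<ge> 1"
  defines "h \<equiv> pi * real N"
  shows "norm (2 * of_real pi * \<i> * (\<Sum>k<N. residue (tanh_quotient m n) (tanh_pole k)) -
           integral {-h..h} (\<lambda>x. tanh_quotient m n (of_real x))) \<le> 2 ^ Suc m / h ^ Suc n * (4 * h)"
proof -
  let ?F = "tanh_quotient m n"
  \<comment> \<open>The strip ends at the heights of the nearest poles below and above the
    rectangle, so the poles inside it are exactly \<open>pts\<close>.\<close>
  define S where "S = {z. Im z > - (pi / 2)} \<inter> {z. Im z < pi * (real N + 1 / 2)}"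
  define pts where "pts = tanh_pole ` {..<N}"
  define \<gamma> where "\<gamma> = rectpath (of_real (-h)) (Complex h h)"
  \<comment> \<open>\<open>h \<ge> 1\<close> is what makes the case
    \<open>\<bar>Re z\<bar> \<ge> 1\<close> of the \<open>tanh\<close> bound available on the
    vertical sides.\<close>
  have "1 * 1 \<le> pi * real N"
    using pi_gt3 assms by (intro mult_mono) auto
  hence "h \<ge> 1" by (simp add: h_def)
  hence "h > 0" by simp
  have h_less: "h < pi * (real N + 1 / 2)"
    by (simp add: h_def)
  have cosh_nz: "cosh z \<noteq> 0" if "z \<in> S - pts" for z
  proof
    assume "cosh z = 0"
    moreover have "- (pi / 2) < Im z"
      using that by (simp add: S_def)
    ultimately obtain k where k: "z = tanh_pole k"
      using cosh_eq_0_iff_tanh_pole by blast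
    have "pi * (real k + 1 / 2) < pi * (real N + 1 / 2)"
      using that by (simp add: k S_def tanh_pole_def algebra_simps)
    hence "k < N"
      by simp
    thus False
      using that k by (auto simp: pts_def)
  qed
  have holo: "?F holomorphic_on S - pts"
    unfolding tanh_quotient_def using cosh_nz by (intro holomorphic_intros) auto
  have box: "z \<in> box (of_real (-h)) (Complex h h)" if "z \<in> pts" for z
  proof -
    from that obtain k where k: "k < N" "z = tanh_pole k" by (auto simp: pts_def)
    have "pi * (real k + 1 / 2) < pi * real N"
      using k by (intro mult_strict_left_mono) auto
    moreover have "0 < pi * (real k + 1 / 2)"
      by simp
    ultimately show ?thesis
      using \<open>h > 0\<close> unfolding k in_box_complex_iff
      by (auto simp: tanh_pole_def h_def algebra_simps)
  qed
  have cbox: "cbox (of_real (-h)) (Complex h h) \<subseteq> S"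
  proof
    fix z assume "z \<in> cbox (of_real (-h)) (Complex h h)"
    hence "0 \<le> Im z" "Im z \<le> h"
      by (auto simp: in_cbox_complex_iff)
    moreover have "- (pi / 2) < 0" by simp
    ultimately show "z \<in> S"
      using h_less unfolding S_def by (blast intro: less_le_trans le_less_trans)
  qed
  have pathim: "path_image \<gamma> = cbox (of_real (-h)) (Complex h h) - box (of_real (-h)) (Complex h h)"
    using \<open>h > 0\<close> unfolding \<gamma>_def by (intro path_image_rectpath_cbox_minus_box) auto
  have sub: "path_image \<gamma> \<subseteq> S - pts"
    using cbox box unfolding pathim by blast
  have "contour_integral \<gamma> ?F = of_real (2 * pi) * \<i> * (\<Sum>p\<in>pts. winding_number \<gamma> p * residue ?F p)"
  proof (rule Residue_theorem[OF _ _ _ holo _ _ sub])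
    show "open S"
      unfolding S_def by (intro open_Int open_halfspace_Im_gt open_halfspace_Im_lt)
    show "connected S"
      unfolding S_def
      by (intro convex_connected convex_Int convex_halfspace_Im_gt convex_halfspace_Im_lt)
    show "\<forall>z. z \<notin> S \<longrightarrow> winding_number \<gamma> z = 0"
      unfolding \<gamma>_def using cbox \<open>h > 0\<close> by (intro allI impI winding_number_rectpath_outside) auto
  qed (auto simp: \<gamma>_def pts_def)
  also have "(\<Sum>p\<in>pts. winding_number \<gamma> p * residue ?F p) = (\<Sum>p\<in>pts. residue ?F p)"
    unfolding \<gamma>_def using winding_number_rectpath[OF box] by (intro sum.cong) auto
  also have "\<dots> = (\<Sum>k<N. residue ?F (tanh_pole k))"
    unfolding pts_def using inj_tanh_pole by (subst sum.reindex) (auto intro: inj_on_subset)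
  finally have res: "contour_integral \<gamma> ?F = 2 * of_real pi * \<i> * (\<Sum>k<N. residue ?F (tanh_pole k))"
    by simp

  define l1 l2 l3 l4 where "l1 = linepath (of_real (-h)) (of_real h :: complex)"
    and "l2 = linepath (of_real h) (Complex h h)" and "l3 = linepath (Complex h h) (Complex (-h) h)"
    and "l4 = linepath (Complex (-h) h) (of_real (-h))"
  note l_defs = l1_def l2_def l3_def l4_def
  have \<gamma>_eq: "\<gamma> = l1 +++ l2 +++ l3 +++ l4"
    unfolding \<gamma>_def rectpath_def Let_def l_defs by (simp add: complex_of_real_def)
  have sub': "path_image l1 \<union> path_image l2 \<union> path_image l3 \<union> path_image l4 \<subseteq> S - pts"
    using sub unfolding \<gamma>_eq by (simp add: path_image_join l_defs)
  have cont: "continuous_on X ?F" if "X \<subseteq> S - pts" for X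
    using holo that holomorphic_on_imp_continuous_on continuous_on_subset by blast
  have int: "?F contour_integrable_on l1" "?F contour_integrable_on l2"
            "?F contour_integrable_on l3" "?F contour_integrable_on l4"
    unfolding l_defs
    by (intro contour_integrable_continuous_linepath cont; use sub' in \<open>simp add: l_defs\<close>)+
  have "contour_integral \<gamma> ?F = contour_integral l1 ?F + contour_integral l2 ?F +
          contour_integral l3 ?F + contour_integral l4 ?F"
    unfolding \<gamma>_eq using int
    by (simp add: l_defs)
  also have "contour_integral l1 ?F = integral {-h..h} (\<lambda>x. ?F (of_real x))"
    unfolding l1_def using \<open>h > 0\<close> by (subst contour_integral_linepath_Reals_eq) auto
  finally have "contour_integral \<gamma> ?F - integral {-h..h} (\<lambda>x. ?F (of_real x)) =
      contour_integral l2 ?F + contour_integral l3 ?F + contour_integral l4 ?F"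
    by simp
  moreover have "norm (contour_integral l2 ?F + contour_integral l3 ?F + contour_integral l4 ?F) \<le>
      2 ^ Suc m / h ^ Suc n * (4 * h)"
  proof -
    let ?B = "2 ^ Suc m / h ^ Suc n"
    have "?B \<ge> 0" using \<open>h > 0\<close> by simp
    have vert: "norm (?F z) \<le> ?B" if "\<bar>Re z\<bar> = h" for z
      using that abs_Re_le_cmod[of z] \<open>h \<ge> 1\<close> assms(1) by (intro norm_tanh_quotient_le) auto
    \<comment> \<open>Here it matters that \<open>h\<close> is a multiple of pi: the top side falls
      under the other case of the \<open>tanh\<close> bound.\<close>
    have "cos (2 * h) = 1"
      using cos_npi[of "2 * N"] by (simp add: h_def mult_ac)
    hence hor: "norm (?F z) \<le> ?B" if "Im z = h" for z
      using that abs_Im_le_cmod[of z] \<open>h \<ge> 1\<close> assms(1) by (intro norm_tanh_quotient_le) auto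
    have "norm (contour_integral l2 ?F) \<le> ?B * norm (Complex h h - of_real h)"
      using int \<open>?B \<ge> 0\<close> \<open>h > 0\<close> unfolding l2_def
      by (intro contour_integral_bound_linepath vert) (auto simp: closed_segment_same_Re)
    also have "norm (Complex h h - of_real h) = h"
      using \<open>h > 0\<close> by (simp add: cmod_def)
    finally have 2: "norm (contour_integral l2 ?F) \<le> ?B * h" .
    have "norm (contour_integral l3 ?F) \<le> ?B * norm (Complex (-h) h - Complex h h)"
      using int \<open>?B \<ge> 0\<close> unfolding l3_def
      by (intro contour_integral_bound_linepath hor) (auto simp: closed_segment_same_Im)
    also have "norm (Complex (-h) h - Complex h h) = 2 * h"
      using \<open>h > 0\<close> by (simp add: cmod_def real_sqrt_mult)
    finally have 3: "norm (contour_integral l3 ?F) \<le> ?B * (2 * h)" .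
    have "norm (contour_integral l4 ?F) \<le> ?B * norm (of_real (-h) - Complex (-h) h)"
      using int \<open>?B \<ge> 0\<close> \<open>h > 0\<close> unfolding l4_def
      by (intro contour_integral_bound_linepath vert) (auto simp: closed_segment_same_Re)
    also have "norm (of_real (-h) - Complex (-h) h) = h"
      using \<open>h > 0\<close> by (simp add: cmod_def)
    finally have 4: "norm (contour_integral l4 ?F) \<le> ?B * h" .
    have "norm (contour_integral l2 ?F + contour_integral l3 ?F + contour_integral l4 ?F) \<le>
        ?B * h + ?B * (2 * h) + ?B * h"
      by (intro order.trans[OF norm_triangle_ineq] add_mono 2 3 4)
    also have "\<dots> = ?B * (h + 2 * h + h)"
      by (simp only: distrib_left)
    finally show ?thesis by simp
  qed
  ultimately show ?thesis
    unfolding res by simp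
qed

text \<open>The contour bound simplifies to a constant times \<open>1 / h ^ n\<close>, which
  vanishes in the limit because \<open>n \<ge> 1\<close>.\<close>

lemma tanh_quotient_integral_tendsto:
  fixes m n :: nat
  assumes "n \<ge> 1" "n \<le> m"
    and "(\<lambda>k. residue (tanh_quotient m n) (tanh_pole k)) sums R"
  shows "(\<lambda>N. integral {- (pi * real N)..pi * real N} (\<lambda>x. tanh_quotient m n (of_real x)))
           \<longlonglongrightarrow> 2 * of_real pi * \<i> * R"
proof -
  let ?I = "\<lambda>N. integral {- (pi * real N)..pi * real N} (\<lambda>x. tanh_quotient m n (of_real x))"
  let ?R = "\<lambda>N. 2 * of_real pi * \<i> * (\<Sum>k<N. residue (tanh_quotient m n) (tanh_pole k))"
  let ?h = "\<lambda>N. pi * real N"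
  have "(\<lambda>N. ?R N - ?I N) \<longlonglongrightarrow> 0"
  proof (rule Lim_null_comparison)
    show "\<forall>\<^sub>F N in sequentially. norm (?R N - ?I N) \<le> 4 * 2 ^ Suc m * (1 / ?h N ^ n)"
      using eventually_ge_at_top[of 1]
    proof eventually_elim
      case (elim N)
      have "2 ^ Suc m / ?h N ^ Suc n * (4 * ?h N) = 4 * 2 ^ Suc m * (1 / ?h N ^ n)"
        using elim by simp
      thus ?case
        using tanh_quotient_contour_bound[OF assms(2) elim] by simp
    qed
    have "filterlim (\<lambda>N. ?h N) at_top sequentially"
      by (intro filterlim_tendsto_pos_mult_at_top[OF tendsto_const] filterlim_real_sequentially) auto
    hence "filterlim (\<lambda>N. ?h N ^ n) at_top sequentially"
      using assms by (intro filterlim_pow_at_top) auto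
    hence "(\<lambda>N. 1 / ?h N ^ n) \<longlonglongrightarrow> 0"
      by (intro tendsto_divide_0[OF tendsto_const] filterlim_at_top_imp_at_infinity)
    from tendsto_mult_right_zero[OF this]
    show "(\<lambda>N. 4 * 2 ^ Suc m * (1 / ?h N ^ n)) \<longlonglongrightarrow> 0" .
  qed
  moreover have "?R \<longlonglongrightarrow> 2 * of_real pi * \<i> * R"
    using assms(3) by (intro tendsto_mult tendsto_const) (auto simp: sums_def)
  ultimately have "(\<lambda>N. ?R N - (?R N - ?I N)) \<longlonglongrightarrow> 2 * of_real pi * \<i> * R - 0"
    by (intro tendsto_diff)
  thus ?thesis by simp
qed

section \<open>Passage to the real integral\<close>

lemma complex_tanh_of_real: "tanh (complex_of_real x) = of_real (tanh x)"
  by (simp add: tanh_def sinh_field_def cosh_field_def flip: exp_of_real of_real_minus)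

lemma complex_cosh_of_real_nonzero: "cosh (complex_of_real x) \<noteq> 0"
proof -
  have "cosh (complex_of_real x) = of_real (cosh x)"
    by (simp add: cosh_field_def flip: exp_of_real of_real_minus)
  thus ?thesis by simp
qed

lemma tanh_quotient_of_real:
  assumes "n \<le> m" "x \<noteq> 0"
  shows "tanh_quotient m n (of_real x) = of_real (tanh x ^ Suc m / x ^ Suc n)"
  using assms by (simp add: tanh_quotient_eq complex_tanh_of_real)

lemma tanh_quotient_in_Reals: "tanh_quotient m n (of_real x) \<in> \<real>"
  by (auto simp: tanh_quotient_def tanhc_def complex_tanh_of_real)

lemma tanh_quotient_minus:
  assumes "n \<le> m" "even (m + n)"
  shows "tanh_quotient m n (-z) = tanh_quotient m n z"
  using assms by (simp add: tanh_quotient_def tanhc_def)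

text \<open>Evenness halves the symmetric integrals. Since the integrand is nonnegative on the
  half-line, a limit along the single sequence \<open>pi * real N\<close> suffices: monotone
  convergence yields integrability and the value together.\<close>

lemma set_integral_tanh_quotient:
  fixes m n :: nat
  assumes "n \<le> m" "even (m + n)"
    and lim: "(\<lambda>N. integral {- (pi * real N)..pi * real N} (\<lambda>x. tanh_quotient m n (of_real x)))
                \<longlonglongrightarrow> 2 * L"
  shows "set_integrable lborel {0<..} (\<lambda>x::real. tanh x ^ Suc m / x ^ Suc n)"
    and "of_real (LBINT x:{0<..}. tanh x ^ Suc m / x ^ Suc n) = L"
proof -
  define f where "f = (\<lambda>x. Re (tanh_quotient m n (of_real x)))"
  define h where "h = (\<lambda>N. pi * real N)"
  have h: "h N \<ge> 0" for N by (simp add: h_def)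
  have f: "tanh_quotient m n (of_real x) = of_real (f x)" for x
    using tanh_quotient_in_Reals[of m n x] by (simp add: f_def)
  have f_eq: "f x = tanh x ^ Suc m / x ^ Suc n" if "x \<noteq> 0" for x
    using tanh_quotient_of_real[OF assms(1) that] unfolding f of_real_eq_iff .
  have "tanh_quotient m n holomorphic_on {z. cosh z \<noteq> 0}"
    unfolding tanh_quotient_def by (intro holomorphic_intros) auto
  hence "continuous_on {z. cosh z \<noteq> 0} (tanh_quotient m n)"
    by (rule holomorphic_on_imp_continuous_on)
  hence cont: "continuous_on A f" for A
    unfolding f_def
    by (intro continuous_intros continuous_on_compose2[where f = of_real])
       (auto simp: complex_cosh_of_real_nonzero)
  have f_nonneg: "f x \<ge> 0" if "x \<ge> 0" for x
  proof (cases "x = 0")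
    case False
    thus ?thesis using that by (simp add: f_eq)
  qed (simp add: f_def tanh_quotient_def tanhc_def)
  have f_int: "f integrable_on {a..b}" for a b
    by (intro integrable_continuous_interval cont)
  have f_minus: "f (-x) = f x" for x
    using tanh_quotient_minus[OF assms(1,2), of "of_real x"] by (simp add: f_def)

  have sym: "integral {- h N..h N} (\<lambda>x. tanh_quotient m n (of_real x)) = 2 * of_real (integral {0..h N} f)" for N
  proof -
    have "integral {- h N..h N} (of_real \<circ> f) = complex_of_real (integral {- h N..h N} f)"
      by (intro integral_linear f_int bounded_linear_of_real)
    also have "integral {- h N..h N} f = integral {- h N..0} f + integral {0..h N} f"
      using h by (intro Henstock_Kurzweil_Integration.integral_combine[symmetric] f_int) auto
    also have "integral {- h N..0} f = integral {0..h N} f"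
      using Henstock_Kurzweil_Integration.integral_reflect_real[of "h N" 0 f] by (simp add: f_minus)
    finally show ?thesis
      by (simp add: f o_def)
  qed
  have "(\<lambda>N. 2 * complex_of_real (integral {0..h N} f)) \<longlonglongrightarrow> 2 * L"
    using lim unfolding sym[unfolded h_def] h_def .
  hence lim': "(\<lambda>N. complex_of_real (integral {0..h N} f)) \<longlonglongrightarrow> L"
    by (subst (asm) tendsto_mult_left_iff) auto
  hence lim_Re: "(\<lambda>N. integral {0..h N} f) \<longlonglongrightarrow> Re L"
    using tendsto_Re by fastforce
  hence "(\<lambda>N. complex_of_real (integral {0..h N} f)) \<longlonglongrightarrow> of_real (Re L)"
    by (rule tendsto_of_real)
  \<comment> \<open>\<open>L\<close> is a limit of real numbers, hence real.\<close>
  hence L: "of_real (Re L) = L"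
    using lim' LIMSEQ_unique by blast

  have set_int: "set_integrable lborel {0..h N} f" for N
    by (rule borel_integrable_atLeastAtMost') (rule cont)
  have hb: "has_bochner_integral lborel (\<lambda>x. indicator {0..} x *\<^sub>R f x) (Re L)"
  proof (rule has_bochner_integral_monotone_convergence)
    show "integrable lborel (\<lambda>x. indicator {0..h N} x *\<^sub>R f x)" for N
      using set_int by (simp add: set_integrable_def)
    show "AE x in lborel. mono (\<lambda>N. indicator {0..h N} x *\<^sub>R f x)"
    proof (intro AE_I2 monoI)
      fix x :: real and M N :: nat
      assume "M \<le> N"
      hence "h M \<le> h N" by (simp add: h_def)
      thus "indicator {0..h M} x *\<^sub>R f x \<le> indicator {0..h N} x *\<^sub>R f x"
        using f_nonneg[of x] by (auto simp: indicator_def)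
    qed
    show "AE x in lborel. (\<lambda>N. indicator {0..h N} x *\<^sub>R f x) \<longlonglongrightarrow> indicator {0..} x *\<^sub>R f x"
    proof (intro AE_I2 tendsto_eventually)
      fix x :: real
      have "filterlim h at_top sequentially"
        unfolding h_def
        by (intro filterlim_tendsto_pos_mult_at_top[OF tendsto_const] filterlim_real_sequentially) auto
      hence "\<forall>\<^sub>F N in sequentially. x \<le> h N"
        by (simp add: filterlim_at_top)
      thus "\<forall>\<^sub>F N in sequentially. indicator {0..h N} x *\<^sub>R f x = indicator {0..} x *\<^sub>R f x"
        by eventually_elim (auto simp: indicator_def)
    qed
    have "(LBINT x:{0..h N}. f x) = integral {0..h N} f" for N
      by (rule set_borel_integral_eq_integral(2)[OF set_int])
    thus "(\<lambda>N. LBINT x. indicator {0..h N} x *\<^sub>R f x) \<longlonglongrightarrow> Re L"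
      using lim_Re by (simp add: set_lebesgue_integral_def)
    show "(\<lambda>x. indicator {0..} x *\<^sub>R f x) \<in> borel_measurable lborel"
      using borel_measurable_continuous_onI[OF cont[of UNIV]] by measurable
  qed
  \<comment> \<open>The two sides can differ only at 0, where \<open>f\<close> takes the filled-in
    value; a single point is a null set.\<close>
  have ae: "AE x in lborel. indicator {0..} x *\<^sub>R f x =
      indicator {0<..} x *\<^sub>R (tanh x ^ Suc m / x ^ Suc n)"
    using AE_lborel_singleton[of 0]
  proof eventually_elim
    case (elim x)
    thus ?case using f_eq[of x] by (auto simp: indicator_def)
  qed
  have meas: "(\<lambda>x::real. indicator {0<..} x *\<^sub>R (tanh x ^ Suc m / x ^ Suc n)) \<in> borel_measurable lborel"
  proof -
    have "(\<lambda>x::real. indicator {0<..} x *\<^sub>R (tanh x ^ Suc m / x ^ Suc n)) =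
          (\<lambda>x. indicator {0<..} x *\<^sub>R f x)"
      using f_eq by (auto simp: indicator_def)
    thus ?thesis
      using borel_measurable_continuous_onI[OF cont[of UNIV]] by simp
  qed
  have "has_bochner_integral lborel (\<lambda>x. indicator {0<..} x *\<^sub>R (tanh x ^ Suc m / x ^ Suc n)) (Re L)"
    using hb ae meas by (subst has_bochner_integral_cong_AE[symmetric]) auto
  thus "set_integrable lborel {0<..} (\<lambda>x::real. tanh x ^ Suc m / x ^ Suc n)"
    and "of_real (LBINT x:{0<..}. tanh x ^ Suc m / x ^ Suc n) = L"
    using L unfolding set_integrable_def set_lebesgue_integral_def has_bochner_integral_iff by simp_all
qed

section \<open>Closed form of the residue sum\<close>

text \<open>Each residue is a finite sum, so the series over the poles may be taken term by term.
  For \<open>j \<le> m\<close> the exponent \<open>n + m + 1 - j\<close> is at least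
  \<open>n + 1 \<ge> 2\<close>, so every one of these series converges.\<close>

lemma residue_tanh_quotient_sums:
  fixes m n :: nat
  assumes "n \<ge> 1" "n \<le> m"
  defines "a \<equiv> fps_nth (fps_expansion (\<lambda>u. ucot u ^ Suc m) 0)"
  shows "(\<lambda>k. residue (tanh_quotient m n) (tanh_pole k)) sums
           (\<Sum>j\<le>m. \<i> ^ j * a j * (of_nat (n + m - j choose n) * (-1) ^ (m - j)) *
             ((2 ^ (n + m + 1 - j) - 1) * zeta (of_nat (n + m + 1 - j)) /
              (\<i> * of_real pi) ^ (n + m + 1 - j)))"
proof -
  have "(\<lambda>k. \<Sum>j\<le>m. \<i> ^ j * a j * (of_nat (n + m - j choose n) * (-1) ^ (m - j)) *
              (1 / tanh_pole k ^ (n + m + 1 - j))) sums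
           (\<Sum>j\<le>m. \<i> ^ j * a j * (of_nat (n + m - j choose n) * (-1) ^ (m - j)) *
             ((2 ^ (n + m + 1 - j) - 1) * zeta (of_nat (n + m + 1 - j)) /
              (\<i> * of_real pi) ^ (n + m + 1 - j)))"
    using assms by (intro sums_sum sums_mult tanh_pole_sums) auto
  moreover have "residue (tanh_quotient m n) (tanh_pole k) =
      (\<Sum>j\<le>m. \<i> ^ j * a j * (of_nat (n + m - j choose n) * (-1) ^ (m - j)) *
              (1 / tanh_pole k ^ (n + m + 1 - j)))" for k
    unfolding residue_tanh_quotient[OF assms(2)] residue_tanh_power a_def
    by (simp only: times_divide_eq_right mult_1_right)
  ultimately show ?thesis
    by (simp only:)
qed

text \<open>Odd \<open>j\<close> contribute nothing, and even \<open>j\<close> are reindexed by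
  \<open>j = m + n - 2 * p\<close>. Then \<open>j \<le> m\<close> becomes
  \<open>n \<le> 2 * p\<close>, the lower summation bound. The prefactor is half of
  \<open>2 * pi * \<i>\<close>, for the half-line.\<close>

lemma residue_sum_eq:
  fixes m n :: nat
  assumes "n \<le> m" "even (m + n)"
  defines "a \<equiv> fps_nth (fps_expansion (\<lambda>u. ucot u ^ Suc m) 0)"
  shows "of_real pi * \<i> * (\<Sum>j\<le>m. \<i> ^ j * a j * (of_nat (n + m - j choose n) * (-1) ^ (m - j)) *
             ((2 ^ (n + m + 1 - j) - 1) * zeta (of_nat (n + m + 1 - j)) /
              (\<i> * of_real pi) ^ (n + m + 1 - j))) =
         (-1) ^ ((m - n) div 2) *
         (\<Sum>p = nat \<lceil>real n / 2\<rceil>..(m + n) div 2.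
            of_nat (2 * p choose n) * (2 ^ (2 * p + 1) - 1) *
            (zeta (of_nat (2 * p + 1)) / of_real pi ^ (2 * p)) * a (m + n - 2 * p))"
    (is "_ * (\<Sum>j\<le>m. ?f j) = ?s * (\<Sum>p\<in>?P. ?g p)")
proof -
  define d where "d = (m - n) div 2"
  have d: "m = n + 2 * d"
    using assms(1,2) by (simp add: d_def)
  have P: "p \<in> ?P \<longleftrightarrow> n \<le> 2 * p \<and> 2 * p \<le> m + n" for p
    using assms(2) by (auto simp: nat_le_iff ceiling_le_iff elim!: evenE)
  have odd: "a j = 0" if "odd j" for j
    using that unfolding a_def by (rule fps_expansion_ucot_power_odd)
  have "of_real pi * \<i> * (\<Sum>j\<le>m. ?f j) = of_real pi * \<i> * (\<Sum>j\<in>{j\<in>{..m}. even j}. ?f j)"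
    using odd by (intro arg_cong2[where f = "(*)"] sum.mono_neutral_right refl) auto
  also have "\<dots> = (\<Sum>j\<in>{j\<in>{..m}. even j}. of_real pi * \<i> * ?f j)"
    by (rule sum_distrib_left)
  also have "\<dots> = (\<Sum>p\<in>?P. ?s * ?g p)"
  proof (rule sum.reindex_bij_witness[of _ "\<lambda>p. m + n - 2 * p" "\<lambda>j. (m + n - j) div 2"])
    fix p assume p: "p \<in> ?P"
    show "(m + n - (m + n - 2 * p)) div 2 = p"
      using p unfolding P by auto
    show "m + n - 2 * p \<in> {j \<in> {..m}. even j}"
      using p assms(2) unfolding P by auto
  next
    fix j assume j: "j \<in> {j \<in> {..m}. even j}"
    then obtain q where q: "j = 2 * q" by auto
    define p where "p = (m + n - j) div 2"
    have p: "p = n + d - q" "q \<le> n + d"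
      using j by (auto simp: p_def d q)
    hence 2: "n + m - j = 2 * p" "n + m + 1 - j = 2 * p + 1" "m - j = 2 * p - n" "n \<le> 2 * p"
      "j = m + n - 2 * p"
      using j by (auto simp: d q)
    show "(m + n - j) div 2 \<in> ?P"
      unfolding P p_def[symmetric] using 2 j by auto
    show "m + n - 2 * ((m + n - j) div 2) = j"
      unfolding p_def[symmetric] using 2 j by auto
    \<comment> \<open>Three signs are collected: \<open>(-1) ^ q\<close> from
      \<open>\<i> ^ j\<close>, \<open>(-1) ^ n\<close> from the binomial series, and
      \<open>(-1) ^ p\<close> from the powers of \<open>\<i> * pi\<close>. As
      \<open>q + n + p = 2 * n + d\<close>, their product is \<open>(-1) ^ d\<close>.\<close>
    have "(-1) ^ (2 * p - n) = (-1 :: complex) ^ n"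
      using 2 by (simp add: minus_one_power_iff)
    moreover have "\<i> ^ j = (-1) ^ q"
      by (simp add: q power_mult)
    moreover have "(-1 :: complex) ^ q * (-1) ^ n * (-1) ^ p = (-1) ^ (q + n + p)"
      by (simp add: power_add)
    moreover have "q + n + p = 2 * n + d"
      using p by simp
    ultimately have sign: "\<i> ^ j * (-1) ^ (2 * p - n) * (-1) ^ p = ?s"
      by (simp add: d power_add power_mult)
    have pi: "of_real pi * \<i> / (\<i> * of_real pi) ^ (2 * p + 1) = (-1) ^ p / of_real pi ^ (2 * p)"
      by (simp add: power_mult_distrib power_mult minus_one_power_iff)
    have "of_real pi * \<i> * ?f j =
        (\<i> ^ j * (-1) ^ (2 * p - n)) * (of_real pi * \<i> / (\<i> * of_real pi) ^ (2 * p + 1)) *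
        (of_nat (2 * p choose n) * (2 ^ (2 * p + 1) - 1) * zeta (of_nat (2 * p + 1)) * a j)"
      unfolding 2(1-3) by (simp only: divide_inverse mult_ac)
    also have "\<dots> = (\<i> ^ j * (-1) ^ (2 * p - n) * (-1) ^ p) * ?g p"
      unfolding pi 2(5)[symmetric] by (simp only: divide_inverse mult_ac)
    finally show "?s * ?g ((m + n - j) div 2) = of_real pi * \<i> * ?f j"
      unfolding sign p_def[symmetric] ..
  qed
  also have "\<dots> = ?s * (\<Sum>p\<in>?P. ?g p)"
    by (rule sum_distrib_left[symmetric])
  finally show ?thesis .
qed

theorem proposition4p4:
  fixes m n :: nat
  assumes "m \<ge> 1" and "n \<ge> 1" and "m \<ge> n" and "even (m + n)"
  shows "set_integrable lborel {0<..} (\<lambda>x::real. tanh x ^ (m + 1) / x ^ (n + 1)) \<and>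
    complex_of_real (LBINT x:{0<..}. tanh x ^ (m + 1) / x ^ (n + 1)) =
      (-1) ^ ((m - n) div 2) *
      (\<Sum>p = nat \<lceil>real n / 2\<rceil>..(m + n) div 2.
         of_nat (2 * p choose n) * (2 ^ (2 * p + 1) - 1) *
         (zeta (of_nat (2 * p + 1)) / of_real pi ^ (2 * p)) *
         fps_nth (fps_expansion (\<lambda>u. ucot u ^ (m + 1)) 0) (m + n - 2 * p))"
proof -
  define R where "R = (\<Sum>k. residue (tanh_quotient m n) (tanh_pole k))"
  have sums: "(\<lambda>k. residue (tanh_quotient m n) (tanh_pole k)) sums R"
    unfolding R_def using residue_tanh_quotient_sums[OF assms(2,3)] by (simp add: sums_iff)
  have lim: "(\<lambda>N. integral {- (pi * real N)..pi * real N} (\<lambda>x. tanh_quotient m n (of_real x)))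
               \<longlonglongrightarrow> 2 * (of_real pi * \<i> * R)"
    using tanh_quotient_integral_tendsto[OF assms(2,3) sums] by (simp add: mult_ac)
  have "R = (\<Sum>j\<le>m. \<i> ^ j * fps_nth (fps_expansion (\<lambda>u. ucot u ^ Suc m) 0) j *
              (of_nat (n + m - j choose n) * (-1) ^ (m - j)) *
             ((2 ^ (n + m + 1 - j) - 1) * zeta (of_nat (n + m + 1 - j)) /
              (\<i> * of_real pi) ^ (n + m + 1 - j)))"
    using residue_tanh_quotient_sums[OF assms(2,3)] sums by (rule sums_unique2[symmetric])
  \<comment> \<open>Folding the finite sum back into \<open>R\<close> yields the closed form of
    \<open>of_real pi * \<i> * R\<close>, which is the limit value in \<open>lim\<close> without its
    factor 2.\<close>
  note R = residue_sum_eq[OF assms(3,4), folded this]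
  show ?thesis
    using set_integral_tanh_quotient[OF assms(3,4) lim] unfolding R Suc_eq_plus1 by blast
qed

end
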